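(* Let $r \geq 2$, $n \geq 1$ and $k \geq 1$ be integers, and suppose $k \leq \frac{r-1}{r}n$. Then the family of all $k$-subsets of $[n]=\{1,2,\ldots,n\}$ cannot be partitioned into fewer than $$\left\lceil n-\frac{r}{r-1}(k-1) \right\rceil$$ $r$-wise intersecting families. This is tight for all admissible values of the parameters: for all such $r,n,k$ the family of all $k$-subsets of $[n]$ can be partitioned into exactly $\left\lceil n-\frac{r}{r-1}(k-1) \right\rceil$ $r$-wise intersecting families.
   Context: A $k$-subset of $[n]$ is a subset of $[n]$ of cardinality exactly $k$. A family of subsets of $[n]$ is called $r$-wise intersecting if any (nonempty) collection of at most $r$ subsets in it has a common point. *)

theory Defs
  imports Complex_Main "HOL-Library.Disjoint_Sets" "HOL-Library.Ramsey"
begin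

text \<open>The conjunct \<open>finite \<G>\<close> is needed because \<open>card\<close> is \<open>0\<close> on infinite sets.\<close>

definition r_wise_intersecting :: "nat \<Rightarrow> 'a set set \<Rightarrow> bool" where
  "r_wise_intersecting r \<F> \<longleftrightarrow>
     (\<forall>\<G>. \<G> \<subseteq> \<F> \<and> \<G> \<noteq> {} \<and> finite \<G> \<and> card \<G> \<le> r \<longrightarrow> \<Inter>\<G> \<noteq> {})"

text \<open>\<open>nsets {1..n} k\<close> is the library's family of all \<open>k\<close>-subsets of \<open>{1..n}\<close>. The parts of
  a partition are nonempty (as \<open>partition_on\<close> requires), so their number is \<open>card P\<close>.\<close>

definition r_wise_intersecting_partition ::
    "nat \<Rightarrow> nat \<Rightarrow> nat \<Rightarrow> nat set set set \<Rightarrow> bool" where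
  "r_wise_intersecting_partition r n k P \<longleftrightarrow>
     partition_on (nsets {1..n} k) P \<and> (\<forall>\<F>\<in>P. r_wise_intersecting r \<F>)"

end

theory Submission
  imports Defs "HOL-Number_Theory.Cong"
begin

text \<open>
The lower bound is a statement about colourings. If the \<open>k\<close>-subsets of an
\<open>n\<close>-set \<open>V\<close> are coloured by \<open>m\<close> colours so that every colour class is \<open>r\<close>-wise
intersecting, then \<open>n (r - 1) \<le> r (k - 1) + m (r - 1)\<close>, which says
\<open>m \<ge> n - r (k - 1) / (r - 1)\<close>. It is proved for prime \<open>r\<close> by topology and then extended to
all \<open>r\<close> by multiplicativity.

\<^emph>\<open>Prime \<open>p\<close>.\<close> The cyclic group of order \<open>p\<close> acts freely on the join of \<open>M = n (p - 1)\<close> copies of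
itself. Assign \<open>p - 1\<close> of these copies to every element of \<open>V\<close>. A face \<open>X\<close> of the join then
determines sets \<open>A i \<subseteq> V\<close>, one for each \<open>i\<close> modulo \<open>p\<close>, and no element lies in all of them, as
it owns only \<open>p - 1\<close> copies. Because the classes are \<open>p\<close>-wise intersecting, no colour \<open>c\<close> can
occur inside all the \<open>A i\<close> either: \<open>p\<close> sets of colour \<open>c\<close>, one in each \<open>A i\<close>, would have a common
point. Give \<open>X\<close> the level \<open>\<Sum>i. card (A i)\<close> if no \<open>A i\<close> contains a \<open>k\<close>-set, and otherwise
\<open>p (k - 1)\<close> plus the number of pairs \<open>(c, i)\<close> such that \<open>A i\<close> contains a set of colour \<open>c\<close>. The
levels are at most \<open>p (k - 1) + m (p - 1)\<close>. An equivariant sign modulo \<open>p\<close> exists because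
\<open>p\<close> is prime, so that proper nonempty subsets of the cyclic group have no symmetry. Levels
grow strictly along inclusions unless the sign stays the same, and the
\<open>p\<close>-fold form of Tucker's lemma (\<open>Zp_Tucker\<close>) says that then \<open>M\<close> levels are needed.

\<^emph>\<open>Tucker's lemma.\<close> The join contains a chain \<open>h d\<close> in every dimension \<open>d < M\<close>, with
\<open>\<partial> h (d + 1) = D h d\<close>, where \<open>D\<close> alternates between \<open>t - 1\<close> and \<open>1 + t + \<dots> + t ^ (p - 1)\<close>
for the generator \<open>t\<close> of the group. Subdivide \<open>h d\<close> barycentrically, read the signs of the
vertices, and evaluate the standard \<open>d\<close>-cocycle of the cyclic group on them. The result is \<open>1\<close>
modulo \<open>p\<close> for every \<open>d\<close> (\<open>degree_one\<close>): the \<open>(d + 1)\<close>-cocycle is the coboundary of a cochain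
whose image under the transpose of \<open>D\<close> is the \<open>d\<close>-cocycle modulo \<open>p\<close>. But with fewer than
\<open>M\<close> levels every flag of \<open>M\<close> faces has two neighbours of equal sign, and the cocycles vanish on such
sequences.

\<^emph>\<open>Products.\<close> Put \<open>q = n - k - m + 1\<close>. The bound fails for \<open>r\<close> exactly if \<open>n < r q + m\<close>. If it fails
for \<open>r1 r2\<close>, let \<open>l = r2 q + m - 1\<close>, which is less than \<open>n\<close> by the bound for \<open>r2\<close>. Every
\<open>(n - l)\<close>-set \<open>T\<close> is an intersection of at most \<open>r2\<close>
\<open>k\<close>-sets of the same colour, by the bound for \<open>r2\<close> on \<open>V - T\<close>. Giving \<open>T\<close> that colour, the
bound for \<open>r1\<close> yields at most \<open>r1\<close> such \<open>T\<close> of one colour with empty intersection, hence at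
most \<open>r1 r2\<close> \<open>k\<close>-sets of one colour without a common point (\<open>product_excess\<close>).

\<^emph>\<open>Tightness.\<close> Sort the \<open>k\<close>-sets by their minimum, putting all those with minimum at least
\<open>m\<close> together. The first \<open>m - 1\<close> classes are stars, and the last one consists of the \<open>k\<close>-subsets of
a set that is too small to be covered by \<open>r\<close> complements of \<open>k\<close>-sets.
\<close>

section \<open>Simplicial cochains and barycentric subdivision\<close>

text \<open>A simplex is the list of its vertices and a cochain is an integer-valued function on lists.
Unfolding the recursion gives the usual alternating sum of \<open>f\<close> over the lists in which one
vertex is omitted. A chain is represented throughout by the functional that evaluates cochains on
it, so that no type of chains is needed.\<close>

primrec coboundary :: "('a list \<Rightarrow> int) \<Rightarrow> 'a list \<Rightarrow> int" where
  "coboundary f [] = 0"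
| "coboundary f (x # xs) = f xs - coboundary (\<lambda>r. f (x # r)) xs"

lemma coboundary_diff: "coboundary (\<lambda>l. f l - g l) l = coboundary f l - coboundary g l"
  by (induction l arbitrary: f g) auto

lemma coboundary_zero: "coboundary (\<lambda>l. 0) l = 0"
  by (induction l) auto

lemma coboundary_add: "coboundary (\<lambda>l. f l + g l) l = coboundary f l + coboundary g l"
  by (induction l arbitrary: f g) auto

lemma coboundary_mult: "coboundary (\<lambda>l. c * f l) l = c * coboundary f l"
  by (induction l arbitrary: f) (auto simp: algebra_simps)

lemma coboundary_sum: "finite I \<Longrightarrow> coboundary (\<lambda>l. \<Sum>i\<in>I. f i l) l = (\<Sum>i\<in>I. coboundary (f i) l)"
  by (induction I rule: finite_induct) (auto simp: coboundary_zero coboundary_add)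

lemma coboundary_map: "coboundary f (map h l) = coboundary (\<lambda>r. f (map h r)) l"
  by (induction l arbitrary: f) auto

lemma coboundary_coboundary: "coboundary (coboundary f) l = 0"
proof (induction l arbitrary: f)
  case (Cons x l)
  show ?case by (simp add: coboundary_diff Cons)
qed simp

text \<open>Divisibility by \<open>q\<close> covers congruences modulo \<open>p\<close> and, with \<open>q = 0\<close>, exact equations; the same
device is used for \<open>subdivide\<close> and \<open>orbit_chain\<close> below.\<close>

lemma coboundary_dvd:
  assumes "\<And>r. Suc (length r) = length l \<Longrightarrow> set r \<subseteq> set l \<Longrightarrow> q dvd f r"
  shows "q dvd coboundary f l"
  using assms
proof (induction l arbitrary: f)
  case (Cons x l)
  have "q dvd f l" by (rule Cons.prems) auto
  moreover have "q dvd coboundary (\<lambda>r. f (x # r)) l"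
    by (rule Cons.IH, rule Cons.prems) auto
  ultimately show ?case by simp
qed simp

lemma coboundary_cong:
  assumes "\<And>r. Suc (length r) = length l \<Longrightarrow> set r \<subseteq> set l \<Longrightarrow> f r = g r"
  shows "coboundary f l = coboundary g l"
  using coboundary_dvd[of l 0 "\<lambda>l. f l - g l"] assms by (simp add: coboundary_diff)

text \<open>The value of \<open>f\<close> on the barycentric subdivision of a simplex \<open>l\<close> with \<open>n\<close> vertices, after the
barycentre of each face \<open>X\<close> has been replaced by its label \<open>a X\<close>. It is the cone, with the
barycentre of \<open>l\<close> as apex, over the subdivided boundary; hence flags are listed from
the largest face to the smallest. The number \<open>n\<close> is a parameter only to make the recursion primitive.\<close>

primrec subdivide :: "('v set \<Rightarrow> 'b) \<Rightarrow> nat \<Rightarrow> ('b list \<Rightarrow> int) \<Rightarrow> 'v list \<Rightarrow> int" where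
  "subdivide a 0 f l = f []"
| "subdivide a (Suc n) f l = coboundary (\<lambda>r. subdivide a n (\<lambda>w. f (a (set l) # w)) r) l"

lemma subdivide_diff: "subdivide a n (\<lambda>w. f w - g w) l = subdivide a n f l - subdivide a n g l"
  by (induction n arbitrary: f g l) (auto simp: coboundary_diff)

lemma subdivide_add: "subdivide a n (\<lambda>w. f w + g w) l = subdivide a n f l + subdivide a n g l"
  by (induction n arbitrary: f g l) (auto simp: coboundary_add)

lemma subdivide_zero: "subdivide a n (\<lambda>w. 0) l = 0"
  by (induction n arbitrary: l) (auto simp: coboundary_zero)

lemma subdivide_sum: "finite I \<Longrightarrow> subdivide a n (\<lambda>w. \<Sum>i\<in>I. f i w) l = (\<Sum>i\<in>I. subdivide a n (f i) l)"
  by (induction I rule: finite_induct) (auto simp: subdivide_zero subdivide_add)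

text \<open>Subdivision is a chain map. The boundary of a cone is its base minus the cone over the boundary of
the base, and here the base is itself a subdivided boundary, so the second part vanishes by
\<open>coboundary_coboundary\<close>.\<close>

lemma subdivide_coboundary: "subdivide a (Suc n) (coboundary f) l = coboundary (subdivide a n f) l"
proof (induction n arbitrary: f l)
  case 0
  show ?case by (simp add: coboundary_diff coboundary_zero)
next
  case (Suc n)
  let ?g = "\<lambda>w. f (a (set l) # w)"
  have "subdivide a (Suc (Suc n)) (coboundary f) l
      = coboundary (\<lambda>r. subdivide a (Suc n) (\<lambda>w. f w - coboundary ?g w) r) l"
    by simp
  also have "\<dots> = coboundary (subdivide a (Suc n) f) l - coboundary (\<lambda>r. coboundary (subdivide a n ?g) r) l"
    unfolding subdivide_diff coboundary_diff Suc ..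
  finally show ?case using coboundary_coboundary by (simp del: subdivide.simps)
qed

lemma subdivide_dvd:
  assumes "length l = n"
    and "\<And>Xs. \<lbrakk>length Xs = n; sorted_wrt (\<lambda>A B. B \<subseteq> A) Xs;
           \<forall>X\<in>set Xs. X \<noteq> {} \<and> X \<subseteq> set l\<rbrakk> \<Longrightarrow> q dvd f (map a Xs)"
  shows "q dvd subdivide a n f l"
  using assms
proof (induction n arbitrary: f l)
  case (Suc n)
  have "q dvd subdivide a n (\<lambda>w. f (a (set l) # w)) r"
    if r: "Suc (length r) = length l" "set r \<subseteq> set l" for r
  proof (rule Suc.IH)
    show "length r = n" using r Suc.prems by simp
    fix Xs :: "'a set list"
    assume "length Xs = n" "sorted_wrt (\<lambda>A B. B \<subseteq> A) Xs"
      "\<forall>X\<in>set Xs. X \<noteq> {} \<and> X \<subseteq> set r"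
    then have "q dvd f (map a (set l # Xs))"
      using r Suc.prems(1) by (intro Suc.prems(2)) auto
    then show "q dvd f (a (set l) # map a Xs)" by simp
  qed
  then show ?case by (simp add: coboundary_dvd)
qed simp

lemma subdivide_eq:
  assumes "length l = n" "\<And>w. length w = n \<Longrightarrow> f w = g w"
  shows "subdivide a n f l = subdivide a n g l"
  using subdivide_dvd[of l n 0 "\<lambda>w. f w - g w" a] assms by (simp add: subdivide_diff)

lemma subdivide_map:
  assumes "length l = n"
    and "\<And>X. X \<noteq> {} \<Longrightarrow> X \<subseteq> set l \<Longrightarrow> a (t ` X) = s (a X)"
  shows "subdivide a n f (map t l) = subdivide a n (\<lambda>w. f (map s w)) l"
  using assms
proof (induction n arbitrary: f l)
  case (Suc n)
  have "a (t ` set l) = s (a (set l))" using Suc.prems by (intro Suc.prems) auto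
  moreover have "subdivide a n g (map t r) = subdivide a n (\<lambda>w. g (map s w)) r"
    if "Suc (length r) = length l" "set r \<subseteq> set l" for r g
    using that Suc.prems by (intro Suc.IH) auto
  ultimately show ?case
    by (simp add: coboundary_map) (rule coboundary_cong, simp)
qed simp

section \<open>Equivariant chains in a join of cyclic groups\<close>

text \<open>The differentials of the periodic free resolution of a cyclic group with generator \<open>t\<close> are
multiplication by \<open>t - 1\<close> in odd degrees and by \<open>1 + t + \<dots> + t ^ (p - 1)\<close> in even positive
degrees. This is their transpose, acting on cochains.\<close>

definition dual_diff :: "('v \<Rightarrow> 'v) \<Rightarrow> nat \<Rightarrow> nat \<Rightarrow> ('v list \<Rightarrow> int) \<Rightarrow> 'v list \<Rightarrow> int" where
  "dual_diff t p d f l =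
     (if odd d then f (map t l) - f l else (\<Sum>i<p. f (map (t ^^ i) l)))"

text \<open>Evaluation on the chain \<open>h d\<close> given by \<open>h 0 = x 0\<close> and \<open>h (d + 1) = x (d + 1) * D (h d)\<close>, where
\<open>*\<close> is the join and \<open>D\<close> the differential of degree \<open>d + 1\<close>. The points \<open>x j\<close> represent the
orbits whose join is considered.\<close>

primrec orbit_chain :: "('v \<Rightarrow> 'v) \<Rightarrow> nat \<Rightarrow> (nat \<Rightarrow> 'v) \<Rightarrow> nat \<Rightarrow> ('v list \<Rightarrow> int) \<Rightarrow> int" where
  "orbit_chain t p x 0 f = f [x 0]"
| "orbit_chain t p x (Suc d) f = orbit_chain t p x d (dual_diff t p (Suc d) (\<lambda>l. f (x (Suc d) # l)))"

lemma dual_diff_diff: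
  "dual_diff t p d (\<lambda>l. f l - g l) l = dual_diff t p d f l - dual_diff t p d g l"
  by (simp add: dual_diff_def sum_subtractf)

lemma dual_diff_coboundary: "dual_diff t p d (coboundary f) l = coboundary (dual_diff t p d f) l"
proof (cases "odd d")
  case True
  then have "dual_diff t p d f = (\<lambda>l. f (map t l) - f l)" by (auto simp: dual_diff_def)
  then show ?thesis using True by (simp add: dual_diff_def coboundary_diff coboundary_map)
next
  case False
  then have "dual_diff t p d f = (\<lambda>l. \<Sum>i<p. f (map (t ^^ i) l))" by (auto simp: dual_diff_def)
  then show ?thesis using False by (simp add: dual_diff_def coboundary_sum coboundary_map)
qed

text \<open>This is \<open>(t - 1) (1 + t + \<dots> + t ^ (p - 1)) = t ^ p - 1 = 0\<close>.\<close>

lemma dual_diff_twice: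
  assumes "\<forall>v\<in>set l. (t ^^ p) v = v"
  shows "dual_diff t p d (dual_diff t p (Suc d) f) l = 0"
proof -
  have *: "map (t ^^ p) l = l" using assms by (simp add: map_idI)
  have tele: "(\<Sum>i<p. f (map (t ^^ Suc i) l) - f (map (t ^^ i) l)) = 0"
    using sum_lessThan_telescope[of "\<lambda>i. f (map (t ^^ i) l)" p] * by simp
  show ?thesis
  proof (cases "odd d")
    case True
    then have "dual_diff t p d (dual_diff t p (Suc d) f) l
       = (\<Sum>i<p. f (map (t ^^ i) (map t l))) - (\<Sum>i<p. f (map (t ^^ i) l))"
      by (simp add: dual_diff_def)
    also have "\<dots> = (\<Sum>i<p. f (map (t ^^ Suc i) l) - f (map (t ^^ i) l))"
      by (simp add: sum_subtractf funpow_Suc_right del: funpow.simps)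
    finally show ?thesis using tele by simp
  next
    case False
    then have "dual_diff t p d (dual_diff t p (Suc d) f) l
       = (\<Sum>i<p. f (map (t ^^ Suc i) l) - f (map (t ^^ i) l))"
      by (simp add: dual_diff_def)
    then show ?thesis using tele by simp
  qed
qed

text \<open>The simplices that occur in \<open>h d\<close> are of this form. The order of the orbits is descending because
\<open>h (d + 1)\<close> has its new vertex in front.\<close>

definition orbit_simplex :: "('v \<Rightarrow> 'v) \<Rightarrow> (nat \<Rightarrow> 'v) \<Rightarrow> nat \<Rightarrow> 'v list \<Rightarrow> bool" where
  "orbit_simplex t x d l \<longleftrightarrow> list_all2 (\<lambda>j v. \<exists>i. v = (t ^^ i) (x j)) (rev [0..<Suc d]) l"

lemma orbit_simplex_length: "orbit_simplex t x d l \<Longrightarrow> length l = Suc d"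
  unfolding orbit_simplex_def by (drule list_all2_lengthD) simp

lemma orbit_simplex_map:
  assumes "orbit_simplex t x d l"
  shows "orbit_simplex t x d (map (t ^^ i) l)"
  using assms unfolding orbit_simplex_def list_all2_map2
  by (rule list_all2_mono) (metis comp_apply funpow_add)

lemma orbit_simplex_Cons:
  assumes "orbit_simplex t x d l"
  shows "orbit_simplex t x (Suc d) (x (Suc d) # l)"
proof -
  have "\<exists>i. x (Suc d) = (t ^^ i) (x (Suc d))" by (rule exI[of _ 0]) simp
  then show ?thesis using assms unfolding orbit_simplex_def by simp
qed

lemma orbit_chain_diff: "orbit_chain t p x d (\<lambda>l. f l - g l) = orbit_chain t p x d f - orbit_chain t p x d g"
proof (induction d arbitrary: f g)
  case (Suc d)
  show ?case unfolding orbit_chain.simps dual_diff_diff Suc ..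
qed simp

lemma orbit_chain_dvd:
  assumes "\<And>l. orbit_simplex t x d l \<Longrightarrow> q dvd f l"
  shows "q dvd orbit_chain t p x d f"
  using assms
proof (induction d arbitrary: f)
  case 0
  have "orbit_simplex t x 0 [x 0]" by (auto simp: orbit_simplex_def intro: exI[of _ 0])
  then show ?case using 0 by simp
next
  case (Suc d)
  have "q dvd dual_diff t p (Suc d) (\<lambda>l. f (x (Suc d) # l)) l" if l: "orbit_simplex t x d l" for l
  proof -
    have "q dvd f (x (Suc d) # map (t ^^ i) l)" for i
      by (intro Suc.prems orbit_simplex_Cons orbit_simplex_map l)
    from this[of 1] this[of 0] this show ?thesis
      by (auto simp: dual_diff_def intro!: dvd_sum)
  qed
  then show ?case using Suc.IH by simp
qed

lemma orbit_chain_eq: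
  assumes "\<And>l. orbit_simplex t x d l \<Longrightarrow> f l = g l"
  shows "orbit_chain t p x d f = orbit_chain t p x d g"
  using orbit_chain_dvd[of t x d 0 "\<lambda>l. f l - g l" p] assms by (simp add: orbit_chain_diff)

text \<open>That is, \<open>\<partial> h (d + 1) = D (h d)\<close>: the chain \<open>D (h d)\<close> is a cycle by \<open>dual_diff_twice\<close>, and the
boundary of a cone over a cycle is the cycle.\<close>

lemma orbit_chain_coboundary:
  assumes periodic: "\<And>j. (t ^^ p) (x j) = x j"
  shows "orbit_chain t p x (Suc d) (coboundary f) = orbit_chain t p x d (dual_diff t p (Suc d) f)"
proof (induction d arbitrary: f)
  case 0
  show ?case by (simp add: dual_diff_def)
next
  case (Suc d)
  let ?g = "\<lambda>l. f (x (Suc (Suc d)) # l)"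
  have fixl: "(t ^^ p) v = v" if "orbit_simplex t x d' l" "v \<in> set l" for v l d'
  proof -
    have "\<exists>i j. v = (t ^^ i) (x j)"
      using that by (fastforce simp: orbit_simplex_def list_all2_conv_all_nth in_set_conv_nth)
    then show ?thesis using periodic by (metis add.commute comp_apply funpow_add)
  qed
  have "orbit_chain t p x (Suc (Suc d)) (coboundary f)
     = orbit_chain t p x (Suc d) (dual_diff t p (Suc (Suc d)) (\<lambda>l. f l - coboundary ?g l))"
    by simp
  also have "\<dots> = orbit_chain t p x (Suc d) (dual_diff t p (Suc (Suc d)) f)
      - orbit_chain t p x (Suc d) (coboundary (dual_diff t p (Suc (Suc d)) ?g))"
    unfolding dual_diff_diff orbit_chain_diff dual_diff_coboundary ..
  also have "orbit_chain t p x (Suc d) (coboundary (dual_diff t p (Suc (Suc d)) ?g)) =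
      orbit_chain t p x d (dual_diff t p (Suc d) (dual_diff t p (Suc (Suc d)) ?g))"
    by (rule Suc)
  also have "\<dots> = 0"
    using orbit_chain_dvd[of t x d 0 "dual_diff t p (Suc d) (dual_diff t p (Suc (Suc d)) ?g)" p]
      fixl dual_diff_twice[where t = t and p = p and d = "Suc d" and f = ?g] by auto
  finally show ?case by simp
qed

section \<open>Standard cocycles of a cyclic group\<close>

text \<open>Residues modulo \<open>p\<close> are represented by integers in \<open>{0..<p}\<close>. Walking cyclically from \<open>g\<close> upwards to
\<open>h\<close> passes \<open>0\<close> exactly if \<open>h < g\<close>. The coboundary of this indicator is a cocycle that is
invariant under the shift of all arguments: it tells whether the upward walk from the first residue over the second to
the third one covers at least one full turn.\<close>

definition wrap :: "int \<Rightarrow> int \<Rightarrow> int" where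
  "wrap g h = (if h < g then 1 else 0)"

text \<open>The cup powers of the two-dimensional carry cocycle, the coboundary of \<open>wrap\<close>. A cocycle of dimension \<open>d\<close> takes \<open>d + 1\<close> arguments, so it lives on
lists of odd length; the value \<open>0\<close> on lists of even length makes the vanishing
lemmas below hold for all lists.\<close>

fun even_cocycle :: "int list \<Rightarrow> int" where
  "even_cocycle [g] = 1"
| "even_cocycle (g0 # g1 # g2 # gs) =
     (wrap g1 g2 - wrap g0 g2 + wrap g0 g1) * even_cocycle (g2 # gs)"
| "even_cocycle _ = 0"

text \<open>The cup product of the one-dimensional cocycle \<open>h - g\<close> with an even one.\<close>

definition odd_cocycle :: "int list \<Rightarrow> int" where
  "odd_cocycle w = (hd (tl w) - hd w) * even_cocycle (tl w)"

definition wrap_cochain :: "int list \<Rightarrow> int" where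
  "wrap_cochain w = wrap (hd w) (hd (tl w)) * even_cocycle (tl w)"

text \<open>The two parts need each other. By the Leibniz rule, the coboundary of \<open>wrap_cochain\<close>,
a cup product of \<open>wrap\<close> with an even cocycle, is the next even cocycle once the shorter one
is known to be closed; and a coboundary is closed.\<close>

lemma even_cocycle_and_wrap:
  "(even (length w) \<longrightarrow> coboundary even_cocycle w = 0) \<and>
   (odd (length w) \<and> length w \<ge> 3 \<longrightarrow> coboundary wrap_cochain w = even_cocycle w)"
proof (induction w rule: length_induct)
  case (1 w)
  have "coboundary wrap_cochain w = even_cocycle w" if w: "odd (length w)" "length w \<ge> 3"
  proof -
    obtain a b c r where [simp]: "w = a # b # c # r"
      using w by (auto simp: numeral_3_eq_3 Suc_le_length_iff)
    have "coboundary even_cocycle v = 0" if "even (length v)" "length v < length w" for v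
      using 1 that by blast
    from this[of "b # c # r"] have "coboundary even_cocycle (b # c # r) = 0"
      using w by (simp del: coboundary.simps)
    then have z: "coboundary (\<lambda>s. even_cocycle (b # s)) (c # r) = even_cocycle (c # r)"
      using coboundary.simps(2)[of even_cocycle b "c # r"] by linarith
    have "coboundary wrap_cochain w = wrap b c * even_cocycle (c # r) - wrap a c * even_cocycle (c # r)
        + coboundary (\<lambda>s. wrap a b * even_cocycle (b # s)) (c # r)"
      by (simp add: wrap_cochain_def)
    then show ?thesis unfolding coboundary_mult z by (simp add: algebra_simps)
  qed
  moreover have "coboundary even_cocycle w = 0" if w: "even (length w)"
  proof (cases "length w \<ge> 4")
    case True
    have "coboundary even_cocycle w = coboundary (coboundary wrap_cochain) w"
    proof (rule coboundary_cong)
      fix r :: "int list" assume r: "Suc (length r) = length w"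
      then have "odd (length r)" "length r \<ge> 3" "length r < length w"
        using w True by presburger+
      then show "even_cocycle r = coboundary wrap_cochain r" using 1 by simp
    qed
    then show ?thesis by (simp add: coboundary_coboundary)
  next
    case False
    then have "length w = 0 \<or> length w = 2" using w by presburger
    then show ?thesis by (auto simp: length_Suc_conv numeral_2_eq_2)
  qed
  ultimately show ?case by blast
qed

lemma coboundary_hd_cochain:
  assumes "even (length w)"
  shows "coboundary (\<lambda>w. hd w * even_cocycle w) w = odd_cocycle w"
proof (cases "w = []")
  case False
  then obtain a b r where [simp]: "w = a # b # r"
    using assms by (metis One_nat_def even_Suc length_Cons list.exhaust list.size(3) odd_one)
  have "coboundary (\<lambda>s. even_cocycle (a # s)) (b # r) = even_cocycle (b # r)"
    using even_cocycle_and_wrap[of w] assms by simp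
  moreover have "coboundary (\<lambda>w. hd w * even_cocycle w) w
     = b * even_cocycle (b # r) - coboundary (\<lambda>s. a * even_cocycle (a # s)) (b # r)"
    by simp
  ultimately show ?thesis unfolding coboundary_mult odd_cocycle_def by (simp add: algebra_simps)
qed (simp add: odd_cocycle_def)

text \<open>A shift changes \<open>wrap\<close> by the coboundary of the indicator of the residue \<open>p - 1\<close>, so it leaves the
coboundary of \<open>wrap\<close> unchanged.\<close>

lemma even_cocycle_shift:
  fixes p :: int
  assumes "set w \<subseteq> {0..<p}"
  shows "even_cocycle (map (\<lambda>g. (g + 1) mod p) w) = even_cocycle w"
  using assms
proof (induction w rule: even_cocycle.induct)
  case (2 g0 g1 g2 gs)
  have s: "(g + 1) mod p = (if g = p - 1 then 0 else g + 1)" if "g \<in> {0..<p}" for g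
    using that by auto
  have "wrap ((g1 + 1) mod p) ((g2 + 1) mod p) - wrap ((g0 + 1) mod p) ((g2 + 1) mod p)
      + wrap ((g0 + 1) mod p) ((g1 + 1) mod p) = wrap g1 g2 - wrap g0 g2 + wrap g0 g1"
    using 2 by (auto simp: s wrap_def)
  with 2 show ?case by simp
qed auto

lemma even_cocycle_shift_of_nat:
  fixes p :: nat
  assumes "set w \<subseteq> {0..<int p}"
  shows "even_cocycle (map (\<lambda>g. (g + int i) mod int p) w) = even_cocycle w"
proof (induction i)
  case 0
  have "map (\<lambda>g. (g + int 0) mod int p) w = w" using assms by (auto intro!: map_idI)
  then show ?case by simp
next
  case (Suc i)
  let ?w = "map (\<lambda>g. (g + int i) mod int p) w"
  have "map (\<lambda>g. (g + int (Suc i)) mod int p) w = map (\<lambda>g. (g + 1) mod int p) ?w"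
    by (simp add: mod_simps algebra_simps)
  moreover have "set ?w \<subseteq> {0..<int p}" using assms by (cases p) auto
  ultimately show ?case using even_cocycle_shift Suc by metis
qed

text \<open>The cocycles are normalised: they vanish on degenerate simplices. This is where the shortage of
levels will enter.\<close>

lemma even_cocycle_repeat:
  assumes "\<not> distinct_adj w"
  shows "even_cocycle w = 0"
  using assms by (induction w rule: even_cocycle.induct) (auto simp: wrap_def)

lemma odd_cocycle_repeat:
  assumes "\<not> distinct_adj w"
  shows "odd_cocycle w = 0"
proof -
  obtain a b r where "w = a # b # r" using assms by (cases w rule: remdups_adj.cases) auto
  then show ?thesis using assms even_cocycle_repeat by (auto simp: odd_cocycle_def)
qed

text \<open>The transpose of \<open>1 + t + \<dots> + t ^ (p - 1)\<close> takes \<open>wrap\<close> to the one-dimensional cocycle \<open>h - g\<close>.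
For each \<open>i\<close>, the difference of the two shifted residues is \<open>(h - g) mod p\<close>, reduced by \<open>p\<close> if they
wrap; summed over a full period the differences cancel.\<close>

lemma sum_wrap:
  fixes p :: nat
  assumes "g \<in> {0..<int p}" "h \<in> {0..<int p}"
  shows "(\<Sum>i<p. wrap ((g + int i) mod int p) ((h + int i) mod int p)) = (h - g) mod int p"
proof -
  have p: "p > 0" using assms by (cases p) auto
  have per: "(\<Sum>i<p. (g + int i) mod int p) = (\<Sum>i<p. int i)" if "g \<in> {0..<int p}" for g
  proof (rule sum.reindex_bij_witness
      [where i = "\<lambda>j. nat ((int j - g) mod int p)" and j = "\<lambda>i. nat ((g + int i) mod int p)"])
  qed (use p in \<open>auto simp: nat_less_iff mod_simps zmod_int[symmetric]\<close>)
  have "(h + int i) mod int p - (g + int i) mod int p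
      = (h - g) mod int p - int p * wrap ((g + int i) mod int p) ((h + int i) mod int p)" for i
  proof -
    define x y where "x = (g + int i) mod int p" and "y = (h + int i) mod int p"
    have xy: "0 \<le> x" "x < int p" "0 \<le> y" "y < int p" using p by (auto simp: x_def y_def)
    have "(h - g) mod int p = (y - x) mod int p" by (simp add: x_def y_def mod_simps)
    also have "\<dots> = y - x + int p * wrap x y"
    proof (cases "y < x")
      case True
      have "(y - x) mod int p = (y - x + int p) mod int p" by simp
      also have "\<dots> = y - x + int p" using xy True by (intro mod_pos_pos_trivial) auto
      finally show ?thesis using True by (simp add: wrap_def)
    next
      case False
      then show ?thesis using xy by (simp add: wrap_def)
    qed
    finally show ?thesis by (simp add: x_def y_def)
  qed
  then have "(\<Sum>i<p. (h + int i) mod int p - (g + int i) mod int p) = (\<Sum>i<p. (h - g) mod int p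
      - int p * wrap ((g + int i) mod int p) ((h + int i) mod int p))" by simp
  then have "0 = int p * ((h - g) mod int p)
      - int p * (\<Sum>i<p. wrap ((g + int i) mod int p) ((h + int i) mod int p))"
    using per[OF assms(1)] per[OF assms(2)] by (simp add: sum_subtractf sum_distrib_left)
  then show ?thesis using p by (simp add: right_diff_distrib[symmetric])
qed

section \<open>Tucker's lemma for cyclic groups\<close>

definition face :: "('v \<Rightarrow> 'v) \<Rightarrow> (nat \<Rightarrow> 'v) \<Rightarrow> nat \<Rightarrow> 'v set \<Rightarrow> bool" where
  "face t x d X \<longleftrightarrow> X \<noteq> {} \<and> (\<exists>l. orbit_simplex t x d l \<and> X \<subseteq> set l)"

lemma face_Suc: "face t x d X \<Longrightarrow> face t x (Suc d) X"
  unfolding face_def using orbit_simplex_Cons by (metis set_subset_Cons subset_trans)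

lemma face_image: "face t x d X \<Longrightarrow> face t x d ((t ^^ i) ` X)"
  unfolding face_def using orbit_simplex_map by (metis image_is_empty image_mono set_map)

lemma equivariant_funpow:
  assumes "\<And>X. face t x d X \<Longrightarrow> a X \<in> {0..<int p}"
    and "\<And>X. face t x d X \<Longrightarrow> a (t ` X) = (a X + 1) mod int p"
    and "face t x d X"
  shows "a ((t ^^ i) ` X) = (a X + int i) mod int p"
proof (induction i)
  case 0
  then show ?case using assms(1)[OF assms(3)] by simp
next
  case (Suc i)
  have "a ((t ^^ Suc i) ` X) = (a ((t ^^ i) ` X) + 1) mod int p"
    using assms(2)[OF face_image[OF assms(3)]] by (simp add: image_comp)
  then show ?case using Suc by (simp add: mod_simps algebra_simps)
qed

definition std_cocycle :: "nat \<Rightarrow> int list \<Rightarrow> int" where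
  "std_cocycle d = (if even d then even_cocycle else odd_cocycle)"

text \<open>Write the \<open>(d + 1)\<close>-cocycle as the coboundary of \<open>psi\<close>, move the coboundary through the subdivision
to the chain \<open>h (d + 1)\<close>, where it becomes the transposed differential on \<open>h d\<close>, and use the
equivariance of the labels to apply that differential to \<open>psi\<close> itself. For even \<open>d\<close>, \<open>psi\<close> is the
\<open>d\<close>-cocycle multiplied by its first argument, and \<open>t - 1\<close> increases that factor by one modulo
\<open>p\<close>; for odd \<open>d\<close>, \<open>psi\<close> is \<open>wrap_cochain\<close>, and \<open>sum_wrap\<close> applies.\<close>

lemma degree_step:
  assumes periodic: "\<And>j. (t ^^ p) (x j) = x j"
    and range: "\<And>X. face t x d X \<Longrightarrow> a X \<in> {0..<int p}"
    and shift: "\<And>X. face t x d X \<Longrightarrow> a (t ` X) = (a X + 1) mod int p"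
  shows "int p dvd orbit_chain t p x (Suc d) (subdivide a (Suc (Suc d)) (std_cocycle (Suc d)))
             - orbit_chain t p x d (subdivide a (Suc d) (std_cocycle d))"
proof -
  define psi where "psi = (if even d then (\<lambda>w. hd w * even_cocycle w) else wrap_cochain)"
  have coboundary_psi: "coboundary psi w = std_cocycle (Suc d) w" if "length w = Suc (Suc d)" for w
  proof (cases "even d")
    case True
    then show ?thesis using that coboundary_hd_cochain[of w] by (simp add: psi_def std_cocycle_def)
  next
    case False
    then have "odd (length w)" "length w \<ge> 3" using that by (simp, presburger)
    then show ?thesis using that False even_cocycle_and_wrap[of w]
      by (simp add: psi_def std_cocycle_def)
  qed
  have moved: "subdivide a (Suc d) f (map (t ^^ i) l)
      = subdivide a (Suc d) (\<lambda>w. f (map (\<lambda>g. (g + int i) mod int p) w)) l"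
    if "orbit_simplex t x d l" for l i f
    using that orbit_simplex_length[OF that]
    by (intro subdivide_map equivariant_funpow[of t x d a p] range shift) (auto simp: face_def)
  have "orbit_chain t p x (Suc d) (subdivide a (Suc (Suc d)) (std_cocycle (Suc d)))
      = orbit_chain t p x (Suc d) (coboundary (subdivide a (Suc d) psi))"
    unfolding subdivide_coboundary[symmetric]
    by (intro orbit_chain_eq subdivide_eq) (simp_all add: orbit_simplex_length coboundary_psi)
  also have "\<dots> = orbit_chain t p x d (dual_diff t p (Suc d) (subdivide a (Suc d) psi))"
    by (rule orbit_chain_coboundary) (rule periodic)
  also have "int p dvd \<dots> - orbit_chain t p x d (subdivide a (Suc d) (std_cocycle d))"
    unfolding orbit_chain_diff[symmetric]
  proof (rule orbit_chain_dvd)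
    fix l assume l: "orbit_simplex t x d l"
    have flag: "map a Xs \<noteq> []" "length (map a Xs) = Suc d" "set (map a Xs) \<subseteq> {0..<int p}"
      if "length Xs = Suc d" "\<forall>X\<in>set Xs. X \<noteq> {} \<and> X \<subseteq> set l" for Xs
      using that l range by (auto simp: face_def) (metis atLeastLessThan_iff)+
    show "int p dvd dual_diff t p (Suc d) (subdivide a (Suc d) psi) l - subdivide a (Suc d) (std_cocycle d) l"
    proof (cases "even d")
      case True
      have "int p dvd subdivide a (Suc d) (\<lambda>w. psi (map (\<lambda>g. (g + int 1) mod int p) w) - psi w
          - even_cocycle w) l"
      proof (rule subdivide_dvd[OF orbit_simplex_length[OF l]])
        fix Xs assume Xs: "length Xs = Suc d" "\<forall>X\<in>set Xs. X \<noteq> {} \<and> X \<subseteq> set l"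
        define w where "w = map a Xs"
        obtain g r where w: "w = g # r" using flag[OF Xs] by (cases w) (auto simp: w_def)
        have "psi (map (\<lambda>g. (g + int 1) mod int p) w) - psi w - even_cocycle w
            = ((g + 1) mod int p - (g + 1)) * even_cocycle w"
          using True even_cocycle_shift_of_nat[of w p 1] flag[OF Xs]
          by (simp add: psi_def w_def[symmetric] algebra_simps) (simp add: w algebra_simps)
        moreover have "int p dvd (g + 1) mod int p - (g + 1)"
          by (simp add: mod_eq_dvd_iff[symmetric])
        ultimately show "int p dvd psi (map (\<lambda>g. (g + int 1) mod int p) (map a Xs))
            - psi (map a Xs) - even_cocycle (map a Xs)"
          unfolding w_def[symmetric] by simp
      qed
      then show ?thesis
        using True moved[OF l, of psi 1] by (simp add: dual_diff_def subdivide_diff std_cocycle_def del: subdivide.simps)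
    next
      case False
      have "int p dvd subdivide a (Suc d) (\<lambda>w. (\<Sum>i<p. psi (map (\<lambda>g. (g + int i) mod int p) w))
          - odd_cocycle w) l"
      proof (rule subdivide_dvd[OF orbit_simplex_length[OF l]])
        fix Xs assume Xs: "length Xs = Suc d" "\<forall>X\<in>set Xs. X \<noteq> {} \<and> X \<subseteq> set l"
        define w where "w = map a Xs"
        obtain g h r where w: "w = g # h # r"
          using flag(2)[OF Xs] False unfolding w_def[symmetric]
          by (cases w rule: remdups_adj.cases) auto
        have wp: "set (g # h # r) \<subseteq> {0..<int p}"
          using flag(3)[OF Xs] unfolding w_def[symmetric] w .
        have "psi (map (\<lambda>g. (g + int i) mod int p) w)
            = wrap ((g + int i) mod int p) ((h + int i) mod int p) * even_cocycle (h # r)" for i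
          using False even_cocycle_shift_of_nat[of "h # r" p i] wp
          by (simp add: psi_def wrap_cochain_def w)
        then have "(\<Sum>i<p. psi (map (\<lambda>g. (g + int i) mod int p) w)) - odd_cocycle w
            = ((h - g) mod int p - (h - g)) * even_cocycle (h # r)"
          using sum_wrap[of g p h] wp
          by (simp add: sum_distrib_right[symmetric] odd_cocycle_def w left_diff_distrib)
        moreover have "int p dvd (h - g) mod int p - (h - g)"
          by (simp add: mod_eq_dvd_iff[symmetric])
        ultimately show "int p dvd (\<Sum>i<p. psi (map (\<lambda>g. (g + int i) mod int p) (map a Xs)))
            - odd_cocycle (map a Xs)"
          unfolding w_def[symmetric] by simp
      qed
      then show ?thesis
        using False moved[OF l] by (simp add: dual_diff_def subdivide_diff subdivide_sum std_cocycle_def del: subdivide.simps)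
    qed
  qed
  finally show ?thesis .
qed

text \<open>By \<open>degree_step\<close> the value modulo \<open>p\<close> does not depend on \<open>d\<close>, and for \<open>d = 0\<close> it is the value of
the constant cocycle \<open>1\<close> on a single point.\<close>

lemma degree_one:
  assumes periodic: "\<And>j. (t ^^ p) (x j) = x j"
    and "\<And>X. face t x d X \<Longrightarrow> a X \<in> {0..<int p}"
    and "\<And>X. face t x d X \<Longrightarrow> a (t ` X) = (a X + 1) mod int p"
  shows "int p dvd orbit_chain t p x d (subdivide a (Suc d) (std_cocycle d)) - 1"
  using assms(2-)
proof (induction d)
  case 0
  show ?case by (simp add: std_cocycle_def)
next
  case (Suc d)
  have IH: "int p dvd orbit_chain t p x d (subdivide a (Suc d) (std_cocycle d)) - 1"
    by (intro Suc.IH Suc.prems face_Suc)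
  have step: "int p dvd orbit_chain t p x (Suc d) (subdivide a (Suc (Suc d)) (std_cocycle (Suc d)))
             - orbit_chain t p x d (subdivide a (Suc d) (std_cocycle d))"
    by (intro degree_step periodic Suc.prems face_Suc)
  show ?case using dvd_add[OF step IH] by (simp only: add_diff_eq diff_add_cancel)
qed

text \<open>A flag of \<open>d + 1\<close> faces in which neighbouring signs differ has strictly increasing positive
levels, so its largest face has a level above \<open>d\<close>. If there is no such face, then every flag has two
neighbours of the same sign, the cocycle vanishes on the whole subdivided chain, and this contradicts
\<open>degree_one\<close>.\<close>

lemma Zp_Tucker:
  assumes p: "p \<ge> 2"
    and periodic: "\<And>j. (t ^^ p) (x j) = x j"
    and range: "\<And>X. face t x d X \<Longrightarrow> a X \<in> {0..<int p}"
    and shift: "\<And>X. face t x d X \<Longrightarrow> a (t ` X) = (a X + 1) mod int p"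
    and level_pos: "\<And>X. face t x d X \<Longrightarrow> lev X > 0"
    and level_mono: "\<And>X Y. \<lbrakk>face t x d X; face t x d Y; X \<subseteq> Y\<rbrakk> \<Longrightarrow> a X = a Y \<or> lev X < lev Y"
  shows "\<exists>X. face t x d X \<and> d < (lev X :: nat)"
proof (rule ccontr)
  assume none: "\<not> (\<exists>X. face t x d X \<and> d < lev X)"
  have long: "length Xs \<le> lev (hd Xs)"
    if "Xs \<noteq> []" "sorted_wrt (\<lambda>A B. B \<subseteq> A) Xs" "\<forall>X\<in>set Xs. face t x d X" "distinct_adj (map a Xs)"
    for Xs
    using that
  proof (induction Xs rule: induct_list012)
    case (2 X)
    then show ?case using level_pos[of X] by simp
  next
    case (3 X Y Xs)
    then have "length (Y # Xs) \<le> lev Y" by simp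
    moreover have "lev Y < lev X" using 3 level_mono[of Y X] by simp
    ultimately show ?case by simp
  qed simp
  have "orbit_chain t p x d (subdivide a (Suc d) (std_cocycle d)) = orbit_chain t p x d (\<lambda>l. 0)"
  proof (rule orbit_chain_eq)
    fix l assume l: "orbit_simplex t x d l"
    have "0 dvd subdivide a (Suc d) (std_cocycle d) l"
    proof (rule subdivide_dvd[OF orbit_simplex_length[OF l]])
      fix Xs assume Xs: "length Xs = Suc d" "sorted_wrt (\<lambda>A B. B \<subseteq> A) Xs"
        "\<forall>X\<in>set Xs. X \<noteq> {} \<and> X \<subseteq> set l"
      then have faces: "\<forall>X\<in>set Xs. face t x d X" using l by (auto simp: face_def)
      then have "lev (hd Xs) \<le> d" using none Xs(1) by (cases Xs) auto
      then have "\<not> distinct_adj (map a Xs)" using long[of Xs] Xs faces by fastforce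
      then show "0 dvd std_cocycle d (map a Xs)"
        by (simp add: std_cocycle_def even_cocycle_repeat odd_cocycle_repeat)
    qed
    then show "subdivide a (Suc d) (std_cocycle d) l = 0" by simp
  qed
  also have "\<dots> = 0" using orbit_chain_dvd[of t x d 0 "\<lambda>l. 0"] by simp
  finally have "int p dvd 1"
    using degree_one[of p t x d a, OF periodic range shift] by simp
  then show False using p by simp
qed

section \<open>Colourings for a prime number\<close>

definition rotate_col :: "nat \<Rightarrow> 'a \<times> int \<Rightarrow> 'a \<times> int" where
  "rotate_col p = (\<lambda>(y, g). (y, (g + 1) mod int p))"

text \<open>The average of a set of residues, as an element of the field with \<open>p\<close> elements. For
proper nonempty subsets the cardinality is invertible, and the average is an equivariant choice of a
residue.\<close>

definition cyclic_mean :: "nat \<Rightarrow> int set \<Rightarrow> int" where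
  "cyclic_mean p S = ((SOME m. [m * int (card S) = 1] (mod int p)) * \<Sum>S) mod int p"

text \<open>The mean of one nonempty column of \<open>T\<close>. The column is chosen by looking only at the indices of the
nonempty columns, which a rotation does not change.\<close>

definition column_sign :: "nat \<Rightarrow> ('a \<times> int) set \<Rightarrow> int" where
  "column_sign p T = cyclic_mean p (T `` {SOME y. y \<in> fst ` T})"

lemma inj_on_succ_mod: "inj_on (\<lambda>g. (g + 1) mod int p) {0..<int p}"
proof (rule inj_onI)
  fix g h assume gh: "g \<in> {0..<int p}" "h \<in> {0..<int p}" "(g + 1) mod int p = (h + 1) mod int p"
  then have "[g + 1 = h + 1] (mod int p)" by (simp add: cong_def)
  then have "[g = h] (mod int p)" by (simp add: cong_add_rcancel)
  then show "g = h" using gh by (simp add: cong_def)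
qed

lemma cyclic_mean_shift:
  assumes p: "prime p" and S: "S \<subset> {0..<int p}" "S \<noteq> {}"
  shows "cyclic_mean p ((\<lambda>g. (g + 1) mod int p) ` S) = (cyclic_mean p S + 1) mod int p"
proof -
  let ?s = "\<lambda>g. (g + 1) mod int p"
  have fin: "finite S" using S finite_subset by blast
  have inj: "inj_on ?s S" using inj_on_succ_mod S by (blast intro: inj_on_subset)
  define m where "m = (SOME m. [m * int (card S) = 1] (mod int p))"
  have "card S < p" using psubset_card_mono[OF _ S(1)] by simp
  moreover have "card S > 0" using fin S by (simp add: card_gt_0_iff)
  ultimately have "coprime (card S) p"
    using p by (metis coprime_commute prime_imp_coprime nat_dvd_not_less)
  then have "coprime (int (card S)) (int p)" by simp
  then have "\<exists>m. [m * int (card S) = 1] (mod int p)"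
    using cong_solve_coprime_int by (metis mult.commute)
  then have m: "[m * int (card S) = 1] (mod int p)" unfolding m_def by (rule someI_ex)
  have "[\<Sum>(?s ` S) = (\<Sum>g\<in>S. g + 1)] (mod int p)"
    unfolding sum.reindex[OF inj] by (intro cong_sum) (simp add: cong_def)
  then have "[\<Sum>(?s ` S) = \<Sum>S + int (card S)] (mod int p)" by (simp add: sum.distrib)
  then have "[m * \<Sum>(?s ` S) = m * (\<Sum>S + int (card S))] (mod int p)" by (rule cong_scalar_left)
  also have "m * (\<Sum>S + int (card S)) = m * \<Sum>S + m * int (card S)" by (simp add: algebra_simps)
  also have "[\<dots> = m * \<Sum>S + 1] (mod int p)" using m by (intro cong_add) auto
  finally show ?thesis
    unfolding cyclic_mean_def card_image[OF inj] m_def[symmetric]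
    by (simp add: cong_def mod_simps)
qed

lemma mem_rotate_col:
  "(y, h) \<in> rotate_col p ` T \<longleftrightarrow> (\<exists>g. (y, g) \<in> T \<and> h = (g + 1) mod int p)"
  by (auto simp: rotate_col_def image_iff Bex_def split_paired_Ex)

lemma column_sign_rotate:
  assumes "prime p" "T \<noteq> {}" "\<And>y. T `` {y} \<subset> {0..<int p}"
  shows "column_sign p (rotate_col p ` T) = (column_sign p T + 1) mod int p"
proof -
  have "fst ` (rotate_col p ` T) = fst ` T"
    unfolding image_image by (intro image_cong) (auto simp: rotate_col_def split: prod.splits)
  moreover have "(rotate_col p ` T) `` {y} = (\<lambda>g. (g + 1) mod int p) ` (T `` {y})" for y
    by (rule set_eqI) (unfold Image_singleton_iff mem_rotate_col, auto)
  moreover define y where "y = (SOME y. y \<in> fst ` T)"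
  moreover have "\<exists>y. y \<in> fst ` T" using assms(2) by auto
  then have "y \<in> fst ` T" unfolding y_def by (rule someI_ex)
  then have "T `` {y} \<noteq> {}" by auto
  ultimately show ?thesis
    using cyclic_mean_shift[OF assms(1) assms(3)[of y]] by (simp add: column_sign_def)
qed

lemma rotate_col_funpow: "p > 0 \<Longrightarrow> (rotate_col p ^^ i) (y, 0) = (y, int i mod int p)"
  by (induction i) (auto simp: rotate_col_def mod_simps algebra_simps)

text \<open>A face is thus a partial function from \<open>{..d}\<close> to residues, which is the usual domain of signed
vectors in Tucker's lemma.\<close>

lemma face_rotate_col:
  assumes "face (rotate_col p) (\<lambda>j. (j, 0)) d X" "p > 0"
  shows "X \<subseteq> {..d} \<times> {0..<int p}" and "\<And>j g h. (j, g) \<in> X \<Longrightarrow> (j, h) \<in> X \<Longrightarrow> g = h"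
proof -
  obtain l where l: "orbit_simplex (rotate_col p) (\<lambda>j. (j, 0)) d l" "X \<subseteq> set l"
    using assms by (auto simp: face_def)
  have len: "length l = Suc d" using orbit_simplex_length[OF l(1)] .
  have nth: "\<exists>i. l ! m = (d - m, int i mod int p)" if "m < Suc d" for m
  proof -
    have "\<exists>i. l ! m = (rotate_col p ^^ i) (rev [0..<Suc d] ! m, 0)"
      using l(1) that len unfolding orbit_simplex_def list_all2_conv_all_nth by simp
    moreover have "rev [0..<Suc d] ! m = d - m" using that by (simp add: rev_nth del: upt_Suc)
    ultimately show ?thesis using assms(2) by (simp add: rotate_col_funpow)
  qed
  show "X \<subseteq> {..d} \<times> {0..<int p}"
  proof
    fix v assume "v \<in> X"
    then obtain m where "m < Suc d" "v = l ! m" using l len by (metis in_set_conv_nth subsetD)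
    then show "v \<in> {..d} \<times> {0..<int p}" using nth[of m] assms(2) by auto
  qed
  fix j g h assume "(j, g) \<in> X" "(j, h) \<in> X"
  then obtain m m' where m: "m < Suc d" "(j, g) = l ! m" "m' < Suc d" "(j, h) = l ! m'"
    using l len by (metis in_set_conv_nth subsetD)
  then have "j = d - m" "j = d - m'" using nth[of m] nth[of m'] by auto
  then have "m = m'" using m by simp
  then show "g = h" using m by (metis prod.inject)
qed

text \<open>A partition into intersecting families is treated as a colouring because the inductive step for
products has to define new colourings, whose classes may be empty.\<close>

definition intersecting_colouring ::
    "nat \<Rightarrow> 'a set \<Rightarrow> nat \<Rightarrow> ('a set \<Rightarrow> 'c) \<Rightarrow> 'c set \<Rightarrow> bool" where
  "intersecting_colouring r V k col C \<longleftrightarrow> finite V \<and> k \<ge> 1 \<and> finite C \<and> col ` nsets V k \<subseteq> C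
     \<and> (\<forall>c. r_wise_intersecting r {B \<in> nsets V k. col B = c})"

text \<open>The sets \<open>A i\<close> belonging to a face \<open>X\<close> are the sets \<open>{y. (y, i) \<in> T1 X}\<close>, and \<open>T2 X\<close> records the
colours which occur inside them. For both, the residues over a fixed element or colour form a proper
subset, which makes the mean of a column an equivariant sign.\<close>

lemma prime_intersecting_colouring:
  fixes V :: "'a set" and col :: "'a set \<Rightarrow> 'c"
  assumes p: "prime p" and colouring: "intersecting_colouring p V k col C"
  shows "card V * (p - 1) \<le> p * (k - 1) + card C * (p - 1)"
proof (cases "V = {}")
  case False
  have V: "finite V" and k: "k \<ge> 1" and C: "finite C" "\<And>B. B \<in> nsets V k \<Longrightarrow> col B \<in> C"
    and inter: "\<And>c. r_wise_intersecting p {B \<in> nsets V k. col B = c}"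
    using colouring by (auto simp: intersecting_colouring_def)
  have p2: "p \<ge> 2" using p by (rule prime_ge_2_nat)
  obtain e where e: "bij_betw e {..<card V} V" using ex_bij_betw_nat_finite[OF V] atLeast0LessThan by metis
  define d where "d = card V * (p - 1) - 1"
  have d: "Suc d = card V * (p - 1)" using False V p2 by (simp add: d_def card_gt_0_iff)
  \<comment> \<open>The copies of the element \<open>e q\<close> are the \<open>p - 1\<close> indices \<open>j\<close> with \<open>j div (p - 1) = q\<close>.\<close>
  define elt where "elt = (\<lambda>j. e (j div (p - 1)))"
  have elt: "elt j \<in> V" if "j \<le> d" for j
  proof -
    have "j div (p - 1) < card V" using that d p2 by (simp add: div_less_iff_less_mult)
    then show ?thesis using e unfolding elt_def by (auto simp: bij_betw_def)
  qed
  have fibre: "finite {j. j \<le> d \<and> elt j = y} \<and> card {j. j \<le> d \<and> elt j = y} \<le> p - 1" for y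
  proof (cases "\<exists>q<card V. e q = y")
    case True
    then obtain q where q: "q < card V" "e q = y" by blast
    have "{j. j \<le> d \<and> elt j = y} \<subseteq> {q * (p - 1)..<q * (p - 1) + (p - 1)}"
    proof
      fix j assume "j \<in> {j. j \<le> d \<and> elt j = y}"
      then have j: "j \<le> d" "e (j div (p - 1)) = e q" using q by (auto simp: elt_def)
      have "j div (p - 1) < card V" using j d p2 by (simp add: div_less_iff_less_mult)
      then have "j div (p - 1) = q" using j q e by (auto simp: bij_betw_def inj_on_def)
      then show "j \<in> {q * (p - 1)..<q * (p - 1) + (p - 1)}"
        using dividend_less_div_times[of "p - 1" j] div_times_less_eq_dividend[of j "p - 1"] p2
        by auto
    qed
    from card_mono[OF _ this] finite_subset[OF this] show ?thesis by simp
  next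
    case False
    have empty: "{j. j \<le> d \<and> elt j = y} = {}"
    proof (rule ccontr)
      assume "{j. j \<le> d \<and> elt j = y} \<noteq> {}"
      then obtain j where j: "j \<le> d" "e (j div (p - 1)) = y" by (auto simp: elt_def)
      have "j div (p - 1) < card V" using j d p2 by (simp add: div_less_iff_less_mult)
      then show False using False j by blast
    qed
    show ?thesis unfolding empty by simp
  qed
  let ?t = "rotate_col p :: nat \<times> int \<Rightarrow> nat \<times> int" and ?x = "\<lambda>j::nat. (j, 0::int)"
  \<comment> \<open>The elements, respectively colours, that \<open>X\<close> shows at each residue \<open>i\<close>.\<close>
  define T1 where "T1 = (\<lambda>X. map_prod elt id ` (X :: (nat \<times> int) set))"
  define T2 where "T2 = (\<lambda>X. {(c, i). i \<in> {0..<int p} \<and>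
      (\<exists>B \<in> nsets V k. B \<subseteq> {y. (y, i) \<in> T1 X} \<and> col B = c)})"
  have T1_sub: "T1 X \<subseteq> V \<times> {0..<int p}" if "face ?t ?x d X" for X
    using face_rotate_col(1)[OF that] elt p2 unfolding T1_def by fastforce
  have T2_sub: "T2 X \<subseteq> C \<times> {0..<int p}" for X using C by (auto simp: T2_def)
  have T1_fin: "finite (T1 X)" if "face ?t ?x d X" for X
    using T1_sub[OF that] V by (meson finite_SigmaI finite_atLeastLessThan_int finite_subset)
  have T2_fin: "finite (T2 X)" for X
    using T2_sub C by (meson finite_SigmaI finite_atLeastLessThan_int finite_subset)
  have col1: "T1 X `` {y} \<subset> {0..<int p}" if X: "face ?t ?x d X" for X y
  proof -
    let ?J = "{j. j \<le> d \<and> elt j = y}"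
    have "T1 X `` {y} \<subseteq> (\<lambda>j. THE g. (j, g) \<in> X) ` ?J"
    proof
      fix g assume "g \<in> T1 X `` {y}"
      then obtain j where j: "(j, g) \<in> X" "y = elt j" by (auto simp: T1_def)
      then have "(THE g. (j, g) \<in> X) = g" using face_rotate_col(2)[OF X] p2 by (intro the_equality) auto
      moreover have "j \<le> d" using face_rotate_col(1)[OF X] j p2 by auto
      ultimately show "g \<in> (\<lambda>j. THE g. (j, g) \<in> X) ` ?J" using j by (intro image_eqI[of _ _ j]) auto
    qed
    then have "card (T1 X `` {y}) \<le> card ?J"
      using fibre[of y] by (meson surj_card_le)
    then have "card (T1 X `` {y}) < p" using fibre[of y] p2 by linarith
    then have "T1 X `` {y} \<noteq> {0..<int p}" by auto
    then show ?thesis using T1_sub[OF X] by auto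
  qed
  have col2: "T2 X `` {c} \<subset> {0..<int p}" if X: "face ?t ?x d X" for X c
  proof -
    have "T2 X `` {c} \<noteq> {0..<int p}"
    proof
      assume full: "T2 X `` {c} = {0..<int p}"
      have "\<exists>B. B \<in> nsets V k \<and> B \<subseteq> {y. (y, i) \<in> T1 X} \<and> col B = c" if "i \<in> {0..<int p}" for i
      proof -
        have "i \<in> T2 X `` {c}" using that full by simp
        then show ?thesis by (auto simp: T2_def)
      qed
      then obtain B where B: "\<And>i. i \<in> {0..<int p} \<Longrightarrow>
          B i \<in> nsets V k \<and> B i \<subseteq> {y. (y, i) \<in> T1 X} \<and> col (B i) = c"
        by metis
      have "card (B ` {0..<int p}) \<le> p" using card_image_le[of "{0..<int p}" B] by simp
      moreover have "B ` {0..<int p} \<subseteq> {B \<in> nsets V k. col B = c}" using B by blast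
      moreover have "B ` {0..<int p} \<noteq> {}" "finite (B ` {0..<int p})" using p2 by auto
      ultimately have "\<Inter>(B ` {0..<int p}) \<noteq> {}"
        using inter[of c] unfolding r_wise_intersecting_def by blast
      then obtain z where z: "\<forall>i\<in>{0..<int p}. z \<in> B i" by auto
      have "{0..<int p} \<subseteq> T1 X `` {z}" using B z by blast
      then show False using col1[OF X, of z] by auto
    qed
    then show ?thesis using T2_sub[of X] by auto
  qed
  have rot1: "T1 (?t ` X) = rotate_col p ` T1 X" for X
    unfolding T1_def image_image by (intro image_cong) (auto simp: rotate_col_def split: prod.splits)
  have rot2: "T2 (?t ` X) = rotate_col p ` T2 X" if X: "face ?t ?x d X" for X
  proof -
    have mem: "(y, (i + 1) mod int p) \<in> T1 (?t ` X) \<longleftrightarrow> (y, i) \<in> T1 X" if "i \<in> {0..<int p}" for y i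
    proof
      assume "(y, (i + 1) mod int p) \<in> T1 (?t ` X)"
      then obtain g where g: "(y, g) \<in> T1 X" "(g + 1) mod int p = (i + 1) mod int p"
        unfolding rot1 by (auto simp: mem_rotate_col)
      moreover have "g \<in> {0..<int p}" using g T1_sub[OF X] by auto
      ultimately have "g = i" using inj_on_succ_mod[of p] that by (auto dest: inj_onD)
      then show "(y, i) \<in> T1 X" using g by simp
    next
      assume "(y, i) \<in> T1 X"
      then show "(y, (i + 1) mod int p) \<in> T1 (?t ` X)"
        unfolding rot1 by (auto simp: mem_rotate_col)
    qed
    have mem2: "(c, (i + 1) mod int p) \<in> T2 (?t ` X) \<longleftrightarrow> (c, i) \<in> T2 X" if "i \<in> {0..<int p}" for c i
      using that mem[OF that] p2 by (simp add: T2_def)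
    show ?thesis
    proof (intro set_eqI iffI)
      fix v assume v: "v \<in> T2 (?t ` X)"
      obtain c i where [simp]: "v = (c, i)" by force
      have i: "i \<in> {0..<int p}" using v by (simp add: T2_def)
      have "(i - 1) mod int p \<in> {0..<int p}" "((i - 1) mod int p + 1) mod int p = i"
        using i p2 by (auto simp: mod_simps)
      then have "(c, (i - 1) mod int p) \<in> T2 X" "v = rotate_col p (c, (i - 1) mod int p)"
        using mem2[of "(i - 1) mod int p" c] v by (auto simp: rotate_col_def)
      then show "v \<in> rotate_col p ` T2 X" by blast
    next
      fix v assume "v \<in> rotate_col p ` T2 X"
      then obtain c i where "(c, i) \<in> T2 X" "v = (c, (i + 1) mod int p)" by (auto simp: rotate_col_def)
      moreover then have "i \<in> {0..<int p}" by (simp add: T2_def)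
      ultimately show "v \<in> T2 (?t ` X)" using mem2 by simp
    qed
  qed
  have mono: "T1 X \<subseteq> T1 Y \<and> T2 X \<subseteq> T2 Y" if "X \<subseteq> Y" for X Y
  proof -
    have T1: "T1 X \<subseteq> T1 Y" using that unfolding T1_def by (rule image_mono)
    then have "B \<subseteq> {y. (y, i) \<in> T1 X} \<Longrightarrow> B \<subseteq> {y. (y, i) \<in> T1 Y}" for B i by blast
    then have "T2 X \<subseteq> T2 Y" unfolding T2_def by auto
    with T1 show ?thesis by blast
  qed
  have small: "card (T1 X) \<le> p * (k - 1)" if X: "face ?t ?x d X" and empty: "T2 X = {}" for X
  proof -
    let ?A = "\<lambda>i. {y. (y, i) \<in> T1 X}"
    have A: "finite (?A i)" "?A i \<subseteq> V" for i
      using T1_sub[OF X] V finite_subset[of "?A i" V] by auto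
    have "card (?A i) \<le> k - 1" if i: "i \<in> {0..<int p}" for i
    proof (rule ccontr)
      assume "\<not> card (?A i) \<le> k - 1"
      then have "k \<le> card (?A i)" by simp
      then obtain B where "B \<subseteq> ?A i" "card B = k" using obtain_subset_with_card_n by metis
      moreover then have "B \<in> nsets V k"
        using A[of i] by (auto simp: nsets_def intro: finite_subset)
      ultimately have "(col B, i) \<in> T2 X" using i by (auto simp: T2_def)
      then show False using empty by simp
    qed
    then have "(\<Sum>i\<in>{0..<int p}. card (?A i)) \<le> p * (k - 1)"
      using sum_bounded_above[of "{0..<int p}" "\<lambda>i. card (?A i)" "k - 1"] by simp
    moreover have "(T1 X)\<inverse> = (SIGMA i:{0..<int p}. ?A i)" using T1_sub[OF X] by auto
    then have "card (T1 X) = (\<Sum>i\<in>{0..<int p}. card (?A i))"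
      using A card_SigmaI[of "{0..<int p}" ?A] card_inverse[of "T1 X"] by simp
    ultimately show ?thesis by simp
  qed
  have T2_card: "card (T2 X) \<le> card C * (p - 1)" if X: "face ?t ?x d X" for X
  proof -
    have "T2 X = (SIGMA c:C. T2 X `` {c})" using T2_sub[of X] by auto
    then have "card (T2 X) = card (SIGMA c:C. T2 X `` {c})" by (rule arg_cong)
    also have "\<dots> = (\<Sum>c\<in>C. card (T2 X `` {c}))"
      using C(1) finite_Image[OF T2_fin[of X]] by (intro card_SigmaI) auto
    also have "\<dots> \<le> card C * (p - 1)"
    proof -
      have "card (T2 X `` {c}) \<le> p - 1" for c
        using psubset_card_mono[OF _ col2[OF X, of c]] by simp
      then show ?thesis
        using sum_bounded_above[of C "\<lambda>c. card (T2 X `` {c})" "p - 1"] by simp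
    qed
    finally show ?thesis .
  qed
  define a where "a = (\<lambda>X. if T2 X = {} then column_sign p (T1 X) else column_sign p (T2 X))"
  \<comment> \<open>The offset \<open>p * (k - 1)\<close> is the largest level of the first kind, by \<open>small\<close>.\<close>
  define lev where "lev = (\<lambda>X. if T2 X = {} then card (T1 X) else p * (k - 1) + card (T2 X))"
  have T1_ne: "T1 X \<noteq> {}" if "face ?t ?x d X" for X using that by (auto simp: face_def T1_def)
  have "\<exists>X. face ?t ?x d X \<and> d < lev X"
  proof (rule Zp_Tucker[where a = a, OF p2])
    show "(?t ^^ p) (?x j) = ?x j" for j using p2 by (simp add: rotate_col_funpow)
    fix X assume X: "face ?t ?x d X"
    show "a X \<in> {0..<int p}" using p2 by (simp add: a_def column_sign_def cyclic_mean_def)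
    show "a (?t ` X) = (a X + 1) mod int p"
      using column_sign_rotate[OF p T1_ne[OF X] col1[OF X]] column_sign_rotate[OF p _ col2[OF X]]
      by (auto simp: a_def rot1 rot2[OF X])
    show "lev X > 0"
      using T1_ne[OF X] T1_fin[OF X] T2_fin[of X] by (auto simp: lev_def card_gt_0_iff)
    fix Y assume Y: "face ?t ?x d Y" and "X \<subseteq> Y"
    then have sub: "T1 X \<subseteq> T1 Y" "T2 X \<subseteq> T2 Y" using mono by auto
    show "a X = a Y \<or> lev X < lev Y"
    proof (cases "T2 X = {}")
      case True
      show ?thesis
      proof (cases "T2 Y = {}")
        case True
        then show ?thesis using \<open>T2 X = {}\<close> sub psubset_card_mono[OF T1_fin[OF Y], of "T1 X"]
          by (cases "T1 X = T1 Y") (auto simp: a_def lev_def psubset_eq)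
      next
        case False
        then have "card (T2 Y) > 0" using T2_fin by (simp add: card_gt_0_iff)
        then show ?thesis using small[OF X True] False True by (simp add: lev_def)
      qed
    next
      case False
      then show ?thesis using sub psubset_card_mono[OF T2_fin[of Y], of "T2 X"]
        by (cases "T2 X = T2 Y") (auto simp: a_def lev_def psubset_eq)
    qed
  qed
  then obtain X where X: "face ?t ?x d X" "d < lev X" by blast
  have "lev X \<le> p * (k - 1) + card C * (p - 1)"
    using small[OF X(1)] T2_card[OF X(1)] by (auto simp: lev_def)
  then show ?thesis using X d by simp
qed simp

section \<open>Products and arbitrary numbers\<close>

text \<open>In this form, in terms of \<open>n - k - m + 1\<close>, the bound composes well under products.\<close>

lemma prime_excess:
  assumes "prime p" "intersecting_colouring p V k col C"
  shows "int p * (int (card V) - int k - int (card C) + 1) + int (card C) \<le> int (card V)"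
proof -
  have "p \<ge> 1" "k \<ge> 1"
    using assms prime_ge_1_nat by (auto simp: intersecting_colouring_def)
  moreover have "int (card V * (p - 1)) \<le> int (p * (k - 1) + card C * (p - 1))"
    using prime_intersecting_colouring[OF assms] by (simp only: of_nat_le_iff)
  ultimately show ?thesis by (cases p; cases k) (auto simp: algebra_simps)
qed

lemma r_wise_intersecting_subset:
  "r_wise_intersecting r \<F> \<Longrightarrow> \<F>' \<subseteq> \<F> \<Longrightarrow> r_wise_intersecting r \<F>'"
  unfolding r_wise_intersecting_def by (meson subset_trans)

lemma intersecting_colouring_mono:
  "intersecting_colouring r V k col C \<Longrightarrow> s \<le> r \<Longrightarrow> intersecting_colouring s V k col C"
  unfolding intersecting_colouring_def r_wise_intersecting_def by (meson le_trans)

text \<open>Intersections of at most \<open>r2\<close> sets of the same colour yield a coloured family of smaller sets, to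
which the bound for \<open>r1\<close> applies.\<close>

lemma product_excess:
  fixes V :: "'a set" and col :: "'a set \<Rightarrow> 'c"
  assumes r: "r1 \<ge> 2" "r2 \<ge> 2"
    and IH1: "\<And>V k (col :: 'a set \<Rightarrow> 'c) C. intersecting_colouring r1 V k col C \<Longrightarrow>
      int r1 * (int (card V) - int k - int (card C) + 1) + int (card C) \<le> int (card V)"
    and IH2: "\<And>V k (col :: 'a set \<Rightarrow> 'c) C. intersecting_colouring r2 V k col C \<Longrightarrow>
      int r2 * (int (card V) - int k - int (card C) + 1) + int (card C) \<le> int (card V)"
    and colouring: "intersecting_colouring (r1 * r2) V k col C"
  shows "int (r1 * r2) * (int (card V) - int k - int (card C) + 1) + int (card C) \<le> int (card V)"
proof (rule ccontr)
  define n m where "n = card V" and "m = card C"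
  define q where "q = int n - int k - int m + 1"
  assume "\<not> ?thesis"
  then have big: "int n < int r1 * (int r2 * q) + int m" by (simp add: n_def m_def q_def)
  have V: "finite V" and k: "k \<ge> 1" and C: "finite C" "\<And>B. B \<in> nsets V k \<Longrightarrow> col B \<in> C"
    and inter: "\<And>c. r_wise_intersecting (r1 * r2) {B \<in> nsets V k. col B = c}"
    using colouring by (auto simp: intersecting_colouring_def)
  \<comment> \<open>For \<open>q \<le> 0\<close> the failure of the bound would give \<open>n < q + m = n - k + 1\<close>.\<close>
  have q: "q \<ge> 1"
  proof (rule ccontr)
    assume "\<not> q \<ge> 1"
    then have "int r1 * int r2 * q \<le> 1 * q" using r
      by (intro mult_right_mono_neg) (auto simp: int_one_le_iff_zero_less)
    then show False using big k by (simp add: q_def algebra_simps)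
  qed
  have small: "int r2 * q + int m \<le> int n"
    using IH2[OF intersecting_colouring_mono[OF colouring]] r by (simp add: n_def m_def q_def)
  \<comment> \<open>The largest ground set on which the bound for \<open>r2\<close> fails for subsets with
    complements of size \<open>n - k\<close>.\<close>
  define l where "l = nat (int r2 * q + int m - 1)"
  have r2q: "int r2 * q \<ge> 2 * q" using r q by (intro mult_right_mono) auto
  then have "int r2 * q + int m - 1 \<ge> 0" using q by linarith
  then have l: "int l = int r2 * q + int m - 1" by (simp add: l_def)
  define k' where "k' = n - l"
  have k': "int k' = int n - int l" "k' \<ge> 1" using small l by (auto simp: k'_def)
  have k'_less: "int k - int k' \<ge> 1" using r2q q l k' by (simp add: q_def)
  define meets_in where "meets_in = (\<lambda>T c \<G>. \<G> \<subseteq> {B \<in> nsets V k. col B = c} \<and> \<G> \<noteq> {}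
      \<and> finite \<G> \<and> card \<G> \<le> r2 \<and> \<Inter>\<G> \<subseteq> T)"
  have "\<exists>c \<G>. meets_in T c \<G>" if T: "T \<in> nsets V k'" for T
  proof -
    have T': "T \<subseteq> V" "finite T" "card T = k'" using T by (auto simp: nsets_def)
    \<comment> \<open>The \<open>k\<close>-sets containing \<open>T\<close> correspond to the \<open>(k - k')\<close>-subsets of \<open>V - T\<close>, which has size \<open>l\<close>.\<close>
    have cardX: "int (card (V - T)) = int l" using T' V k'(1) card_mono[of V T]
      by (simp add: card_Diff_subset n_def)
    have ext: "T \<union> A \<in> nsets V k" if "A \<in> nsets (V - T) (k - k')" for A
    proof -
      have A: "A \<subseteq> V - T" "finite A" "card A = k - k'" using that by (auto simp: nsets_def)
      then have "card (T \<union> A) = k' + (k - k')" using T' by (subst card_Un_disjoint) auto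
      then show ?thesis using A T' k'_less by (auto simp: nsets_def)
    qed
    have "\<not> intersecting_colouring r2 (V - T) (k - k') (\<lambda>A. col (T \<union> A)) C"
    proof
      assume "intersecting_colouring r2 (V - T) (k - k') (\<lambda>A. col (T \<union> A)) C"
      from IH2[OF this] have "int r2 * (int l - (int k - int k') - int m + 1) + int m \<le> int l"
        using k'_less cardX by (simp add: m_def of_nat_diff)
      moreover have "int l - (int k - int k') - int m + 1 = q" using k' by (simp add: q_def)
      ultimately show False using l by simp
    qed
    then obtain c where
      "\<not> r_wise_intersecting r2 {A \<in> nsets (V - T) (k - k'). col (T \<union> A) = c}"
      using V C ext k'_less by (auto simp: intersecting_colouring_def)
    then obtain \<G> where G: "\<G> \<subseteq> {A \<in> nsets (V - T) (k - k'). col (T \<union> A) = c}" "\<G> \<noteq> {}"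
      "finite \<G>" "card \<G> \<le> r2" "\<Inter>\<G> = {}"
      by (auto simp: r_wise_intersecting_def)
    have "card ((\<union>) T ` \<G>) \<le> r2" using card_image_le[OF G(3)] G(4) by (rule order_trans)
    moreover have "(\<union>) T ` \<G> \<subseteq> {B \<in> nsets V k. col B = c}" using G(1) ext by fast
    moreover have "\<Inter>((\<union>) T ` \<G>) = T \<union> \<Inter>\<G>" using G(2) by blast
    then have "\<Inter>((\<union>) T ` \<G>) \<subseteq> T" using G(5) by simp
    moreover have "(\<union>) T ` \<G> \<noteq> {}" "finite ((\<union>) T ` \<G>)" using G(2,3) by auto
    ultimately show ?thesis unfolding meets_in_def by blast
  qed
  then obtain colT G where G: "\<And>T. T \<in> nsets V k' \<Longrightarrow> meets_in T (colT T) (G T)"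
    by metis
  have "\<not> intersecting_colouring r1 V k' colT C"
  proof
    assume "intersecting_colouring r1 V k' colT C"
    from IH1[OF this] have "int r1 * (int l - int m + 1) + int m \<le> int n"
      using k' by (simp add: n_def m_def algebra_simps)
    then show False using l big by simp
  qed
  moreover have "colT T \<in> C" if T: "T \<in> nsets V k'" for T
  proof -
    obtain B where "B \<in> G T" using G[OF T] by (auto simp: meets_in_def)
    then show ?thesis using G[OF T] C(2)[of B] by (auto simp: meets_in_def)
  qed
  ultimately obtain c where "\<not> r_wise_intersecting r1 {T \<in> nsets V k'. colT T = c}"
    using V C k' by (auto simp: intersecting_colouring_def)
  then obtain \<H> where H: "\<H> \<subseteq> {T \<in> nsets V k'. colT T = c}" "\<H> \<noteq> {}"
      "finite \<H>" "card \<H> \<le> r1" "\<Inter>\<H> = {}"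
    by (auto simp: r_wise_intersecting_def)
  have GH: "G T \<subseteq> {B \<in> nsets V k. col B = c}" "G T \<noteq> {}" "finite (G T)" "card (G T) \<le> r2"
    "\<Inter>(G T) \<subseteq> T" if "T \<in> \<H>" for T
    using G[of T] H(1) that by (auto simp: meets_in_def)
  let ?U = "\<Union>T\<in>\<H>. G T"
  have "card ?U \<le> (\<Sum>T\<in>\<H>. card (G T))" by (rule card_UN_le[OF H(3)])
  also have "\<dots> \<le> card \<H> * r2" using sum_bounded_above[of \<H> "\<lambda>T. card (G T)" r2] GH by simp
  also have "\<dots> \<le> r1 * r2" using H(4) by simp
  finally have "card ?U \<le> r1 * r2" .
  moreover have "?U \<subseteq> {B \<in> nsets V k. col B = c}" using GH(1) by blast
  moreover have "?U \<noteq> {}" "finite ?U" using GH(2,3) H(2,3) by auto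
  ultimately have "\<Inter>?U \<noteq> {}" using inter[of c] unfolding r_wise_intersecting_def by blast
  moreover have "\<Inter>?U \<subseteq> \<Inter>\<H>" using GH(5) by blast
  ultimately show False using H(5) by simp
qed

lemma intersecting_colouring_excess:
  fixes V :: "'a set" and col :: "'a set \<Rightarrow> 'c"
  assumes "r \<ge> 2" "intersecting_colouring r V k col C"
  shows "int r * (int (card V) - int k - int (card C) + 1) + int (card C) \<le> int (card V)"
  using assms
proof (induction r arbitrary: V k col C rule: less_induct)
  case (less r)
  show ?case
  proof (cases "prime r")
    case True
    then show ?thesis using less.prems by (intro prime_excess)
  next
    case False
    obtain r1 r2 where p: "prime r1" "r = r1 * r2"
      using prime_factor_nat[of r] less.prems(1) by (auto elim!: dvdE)
    have "r2 \<noteq> 0" "r2 \<noteq> 1" using p False less.prems(1) by auto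
    then have r: "r = r1 * r2" "1 < r1" "r1 < r" "1 < r2" "r2 < r"
      using p prime_gt_1_nat[OF p(1)] by auto
    show ?thesis unfolding r(1)
    proof (rule product_excess)
      show "intersecting_colouring (r1 * r2) V k col C" using less.prems r(1) by simp
    qed (use r less.IH[of r1] less.IH[of r2] in auto)
  qed
qed

section \<open>Partitions into intersecting families\<close>

lemma partition_card_lower:
  assumes "r \<ge> 2" "k \<ge> 1" "r_wise_intersecting_partition r n k P"
  shows "int r * (int n - int k - int (card P) + 1) + int (card P) \<le> int n"
proof -
  have part: "partition_on (nsets {1..n} k) P" and inter: "\<And>F. F \<in> P \<Longrightarrow> r_wise_intersecting r F"
    using assms(3) by (auto simp: r_wise_intersecting_partition_def)
  have fin: "finite P" using finite_elements[OF finite_imp_finite_nsets part] by simp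
  define col where "col = (\<lambda>B. THE F. F \<in> P \<and> B \<in> F)"
  have col: "col B = F" if "F \<in> P" "B \<in> F" for F B
    unfolding col_def using that partition_onD2[OF part]
    by (intro the_equality) (auto dest: disjointD)
  have colP: "col B \<in> P \<and> B \<in> col B" if "B \<in> nsets {1..n} k" for B
  proof -
    have "B \<in> \<Union>P" using that by (simp only: partition_onD1[OF part])
    then obtain F where "F \<in> P" "B \<in> F" by (rule UnionE)
    then show ?thesis using col by simp
  qed
  have "intersecting_colouring r {1..n} k col P"
    unfolding intersecting_colouring_def
  proof (intro conjI allI)
    show "col ` nsets {1..n} k \<subseteq> P" using colP by auto
    fix c
    show "r_wise_intersecting r {B \<in> nsets {1..n} k. col B = c}"
    proof (cases "c \<in> P")
      case True
      have "{B \<in> nsets {1..n} k. col B = c} \<subseteq> c" using colP by auto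
      then show ?thesis by (rule r_wise_intersecting_subset[OF inter[OF True]])
    next
      case False
      then have "{B \<in> nsets {1..n} k. col B = c} = {}" using colP by auto
      then show ?thesis by (simp only:) (simp add: r_wise_intersecting_def)
    qed
  qed (use assms fin in auto)
  from intersecting_colouring_excess[OF assms(1) this] show ?thesis by simp
qed

text \<open>If at most \<open>r\<close> of these sets had no common point, their complements, of size \<open>card W - k\<close>, would cover
\<open>W\<close>.\<close>

lemma intersecting_if_large:
  assumes "finite W" "k \<ge> 1" "r * card W < r * k + card W"
  shows "r_wise_intersecting r (nsets W k)"
  unfolding r_wise_intersecting_def
proof (intro allI impI notI)
  fix \<G> assume G: "\<G> \<subseteq> nsets W k \<and> \<G> \<noteq> {} \<and> finite \<G> \<and> card \<G> \<le> r" and empty: "\<Inter>\<G> = {}"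
  obtain B where "B \<in> \<G>" using G by blast
  then have kW: "k \<le> card W" using G assms(1) by (auto simp: nsets_def card_mono)
  have "W \<subseteq> (\<Union>B\<in>\<G>. W - B)" using empty by auto
  then have "card W \<le> card (\<Union>B\<in>\<G>. W - B)" using G assms(1) by (intro card_mono) auto
  also have "\<dots> \<le> (\<Sum>B\<in>\<G>. card (W - B))" using G by (intro card_UN_le) simp
  also have "\<dots> = card \<G> * (card W - k)"
    using G by (subst sum.cong[OF refl, of _ _ "\<lambda>_. card W - k"])
      (auto simp: nsets_def card_Diff_subset)
  also have "\<dots> \<le> r * (card W - k)" using G by simp
  finally have "card W \<le> r * card W - r * k" by (simp add: diff_mult_distrib2)
  moreover have "r * k \<le> r * card W" using kW by simp
  ultimately show False using assms(3) by linarith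
qed

text \<open>The classes with minimum \<open>i < m\<close> are stars with centre \<open>i\<close>; the last class consists of the
\<open>k\<close>-subsets of \<open>{m..n}\<close>. The condition \<open>m + k \<le> n + 1\<close> keeps every class nonempty.\<close>

lemma partition_exists:
  assumes k: "k \<ge> 1" and m: "m \<ge> 1" and mk: "m + k \<le> n + 1"
    and last: "r * (n + 1 - m) < r * k + (n + 1 - m)"
  shows "\<exists>P. r_wise_intersecting_partition r n k P \<and> card P = m"
proof -
  define F where "F = (\<lambda>i. {B \<in> nsets {1..n} k. min (Min B) m = i})"
  have B: "B \<noteq> {}" "finite B" "B \<subseteq> {1..n}" "Min B \<in> B" if "B \<in> nsets {1..n} k" for B
  proof -
    show "B \<noteq> {}" "finite B" "B \<subseteq> {1..n}" using that k by (auto simp: nsets_def)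
    then show "Min B \<in> B" by (intro Min_in)
  qed
  have ne: "F i \<noteq> {}" if "i \<in> {1..m}" for i
  proof -
    have "{i..<i + k} \<in> nsets {1..n} k" using that mk by (auto simp: nsets_def)
    moreover have "Min {i..<i + k} = i" using k by (intro Min_eqI) auto
    ultimately have "{i..<i + k} \<in> F i" using that by (simp add: F_def)
    then show ?thesis by blast
  qed
  have inj: "inj_on F {1..m}"
  proof (rule inj_onI)
    fix i j assume "i \<in> {1..m}" "j \<in> {1..m}" "F i = F j"
    moreover then obtain B where "B \<in> F i" using ne by blast
    ultimately show "i = j" by (auto simp: F_def)
  qed
  have "r_wise_intersecting r (F i)" if i: "i \<in> {1..m}" for i
  proof (cases "i < m")
    case True
    have "i \<in> B" if "B \<in> F i" for B
      using that B(4)[of B] True by (auto simp: F_def min_def split: if_splits)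
    then show ?thesis by (fastforce simp: r_wise_intersecting_def)
  next
    case False
    have "F i \<subseteq> nsets {m..n} k"
    proof
      fix A assume "A \<in> F i"
      then have A: "A \<in> nsets {1..n} k" "m \<le> Min A" using False i by (auto simp: F_def)
      then have "A \<subseteq> {m..n}" using B[OF A(1)] by (auto simp: Min_ge_iff)
      then show "A \<in> nsets {m..n} k" using A by (simp add: nsets_def)
    qed
    moreover have "r_wise_intersecting r (nsets {m..n} k)"
      using last k by (intro intersecting_if_large) auto
    ultimately show ?thesis using r_wise_intersecting_subset by blast
  qed
  moreover have "partition_on (nsets {1..n} k) (F ` {1..m})"
  proof (rule partition_onI)
    have "min (Min A) m \<in> {1..m}" if "A \<in> nsets {1..n} k" for A
      using B[OF that] m by auto
    then show "\<Union>(F ` {1..m}) = nsets {1..n} k" by (auto simp: F_def)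
    show "disjnt X Y" if "X \<in> F ` {1..m}" "Y \<in> F ` {1..m}" "X \<noteq> Y" for X Y
      using that by (auto simp: F_def disjnt_def)
    show "{} \<notin> F ` {1..m}" using ne by (metis imageE)
  qed
  ultimately show ?thesis
    using card_image[OF inj] by (intro exI[of _ "F ` {1..m}"]) (auto simp: r_wise_intersecting_partition_def)
qed

theorem theorem1p1:
  fixes r n k :: nat
  assumes "r \<ge> 2" and "n \<ge> 1" and "k \<ge> 1"
    and "real k \<le> (real r - 1) / real r * real n"
  shows "(\<not> (\<exists>P. r_wise_intersecting_partition r n k P \<and>
             int (card P) < \<lceil>real n - real r / (real r - 1) * (real k - 1)\<rceil>)) \<and>
         (\<exists>P. r_wise_intersecting_partition r n k P \<and>
             int (card P) = \<lceil>real n - real r / (real r - 1) * (real k - 1)\<rceil>)"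
proof -
  define x where "x = real n - real r / (real r - 1) * (real k - 1)"
  have r1: "real r - 1 > 0" using assms(1) by simp
  have x: "(real r - 1) * x = (real r - 1) * real n - real r * (real k - 1)"
    using r1 by (simp add: x_def right_diff_distrib)
  \<comment> \<open>Clearing the denominator turns statements about the ceiling of \<open>x\<close> into integer inequalities.\<close>
  have le_iff: "x \<le> of_int z \<longleftrightarrow> (int r - 1) * int n - int r * (int k - 1) \<le> (int r - 1) * z" for z
  proof -
    have "x \<le> of_int z \<longleftrightarrow> (real r - 1) * x \<le> (real r - 1) * of_int z"
      using r1 by simp
    also have "\<dots> \<longleftrightarrow> real_of_int ((int r - 1) * int n - int r * (int k - 1)) \<le> real_of_int ((int r - 1) * z)"
      unfolding x by simp
    finally show ?thesis by (simp only: of_int_le_iff)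
  qed
  have lower: "\<lceil>x\<rceil> \<le> int (card P)" if "r_wise_intersecting_partition r n k P" for P
    using partition_card_lower[OF assms(1,3) that] le_iff[of "int (card P)"]
    by (simp add: ceiling_le_iff algebra_simps)
  have "real r * real k \<le> (real r - 1) * real n"
    using assms(1,4) by (simp add: field_simps)
  moreover have "real r * (real k - 1) = real r * real k - real r" by (simp add: right_diff_distrib)
  ultimately have "0 < (real r - 1) * x" unfolding x using r1 by linarith
  then have "x > 0" using r1 by (rule zero_less_mult_pos)
  then have "\<lceil>x\<rceil> > 0" by simp
  then obtain m where m: "\<lceil>x\<rceil> = int m" "m \<ge> 1"
    by (metis One_nat_def Suc_leI of_nat_0_less_iff zero_less_imp_eq_int)
  have up: "(int r - 1) * int n - int r * (int k - 1) \<le> (int r - 1) * int m"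
    using le_iff[of "int m"] m(1) by (metis le_of_int_ceiling)
  have low: "(int r - 1) * (int m - 1) < (int r - 1) * int n - int r * (int k - 1)"
    using le_iff[of "int m - 1"] m(1) ceiling_le_iff[of x "int m - 1"] by linarith
  have "(int r - 1) * (int m - 1) < (int r - 1) * (int n - (int k - 1))"
  proof -
    have "int r * (int k - 1) \<ge> (int r - 1) * (int k - 1)" using assms(3) by (intro mult_right_mono) auto
    then show ?thesis using low by (simp add: algebra_simps)
  qed
  then have mk: "m + k \<le> n + 1" using assms(1) by (simp add: mult_less_cancel_left)
  have "int (r * (n + 1 - m)) < int (r * k + (n + 1 - m))"
  proof -
    define N where "N = n + 1 - m"
    have n: "int n = int m + int N - 1" using mk by (simp add: N_def)
    show ?thesis using up unfolding N_def[symmetric] n by (simp add: algebra_simps)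
  qed
  then have "r * (n + 1 - m) < r * k + (n + 1 - m)" by (simp only: of_nat_less_iff)
  from partition_exists[OF assms(3) m(2) mk this]
  have "\<exists>P. r_wise_intersecting_partition r n k P \<and> int (card P) = \<lceil>x\<rceil>" using m(1) by auto
  then show ?thesis unfolding x_def[symmetric] using lower by (auto simp: not_less)
qed

end
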